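(* Let $X=(V,E)$ be a (finite or infinite) distance-regular graph and $v_0\in V$ a base point. Then $\mathcal{R}(X)$, with the convolution $\circ_{v_0}$ and the conjugate-linear map $*$ fixing every element of $\mathcal{R}(X)$, is a hermitian discrete hypergroup. Moreover, the hypergroup structure of $\mathcal{R}(X)$ is independent of $v_0$ (that is, $\circ_{v_0}=\circ_{v_1}$ for all $v_0,v_1\in V$).
   Context: **Discrete hypergroup.** For a set $K$, let $\mathbb{C}K$ be the free complex vector space on $K$; for $\mu\in\mathbb{C}K$ let $\mu(x)$ be the coefficient of $x\in K$, $\|\mu\|_1=\sum_{x}|\mu(x)|$, $\mathrm{supp}(\mu)=\{x\in K: \mu(x)\ne 0\}$. $K$, with a bilinear convolution $\circ$ on $\mathbb{C}K$ and a map $*:\mathbb{C}K\to\mathbb{C}K$, is a discrete hypergroup if: (i) $(\mathbb{C}K,\circ,* )$ is an associative $*$-algebra ($*$ is conjugate-linear, involutive and anti-multiplicative) with a neutral element $e\in K$; (ii) for all $x,y,z\in K$, $(x\circ y)(z)\ge 0$ is real, and $\|x\circ y\|_1=1$; (iii) $*$ maps $K$ onto $K$; (iv) for $x,y\in K$, $e\in\mathrm{supp}(x\circ y)$ if and only if $y=x^*$. It is hermitian if $*$ restricted to $K$ is the identity. **Construction from a graph.** All graphs are simple, connected, with all vertices of finite degree; $d$ is the graph distance, $\mathrm{diam}(X)\in\mathbb{N}_0\cup\{\infty\}$ the supremum of distances, $\Gamma_i(v)=\{w\in V: d(v,w)=i\}$. Let $I=\{i\in\mathbb{N}_0: i\le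 \mathrm{diam}(X)\}$, $R_i=\{(v,w)\in V\times V: d(v,w)=i\}$, $\mathcal{R}(X)=\{R_i\}_{i\in I}$. For $v_0\in V$ put $$P_{i,j}^k=\frac{1}{|\Gamma_i(v_0)|}\sum_{v\in\Gamma_i(v_0)}\frac{|\Gamma_j(v)\cap\Gamma_k(v_0)|}{|\Gamma_j(v)|}\qquad(i,j,k\in I)$$ (being well-defined, i.e. all denominators being nonzero, is part of the claim), and define the bilinear convolution $\circ_{v_0}$ on $\mathbb{C}\mathcal{R}(X)$ by $R_i\circ_{v_0}R_j=\sum_{k\in I}P_{i,j}^kR_k$. **Distance-regular graph.** A connected graph $X$ is distance-regular if there exist positive integers $b_i$ ($0\le i<\mathrm{diam}(X)$) and $c_i$ ($i\ge 1$, $i\le\mathrm{diam}(X)$, $i<\infty$) such that: $|\Gamma_1(v)|=b_0$ for all $v\in V$; for $1\le i<\mathrm{diam}(X)$ and all $v,w$ with $d(v,w)=i$, $|\Gamma_{i+1}(v)\cap\Gamma_1(w)|=b_i$ and $|\Gamma_{i-1}(v)\cap\Gamma_1(w)|=c_i$; and, if $s=\mathrm{diam}(X)<\infty$, $|\Gamma_{s-1}(v)\cap\Gamma_1(w)|=c_s$ whenever $d(v,w)=s$. *)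

theory Defs
  imports Complex_Main "HOL-Library.Poly_Mapping" "HOL-Library.Extended_Nat"
begin

section \<open>Discrete hypergroups\<close>

text \<open>The free complex vector space on a set \<open>K\<close> consists of the finitely supported functions
  whose support lies in \<open>K\<close>.  The library's ring multiplication on \<open>\<Rightarrow>\<^sub>0\<close> plays no role.\<close>

definition free_cspace :: "'k set \<Rightarrow> ('k \<Rightarrow>\<^sub>0 complex) set" where
  "free_cspace K = {\<mu>. Poly_Mapping.keys \<mu> \<subseteq> K}"

definition cscale :: "complex \<Rightarrow> ('k \<Rightarrow>\<^sub>0 complex) \<Rightarrow> ('k \<Rightarrow>\<^sub>0 complex)" where
  "cscale c \<mu> = Poly_Mapping.map (\<lambda>a. c * a) \<mu>"

definition point :: "'k \<Rightarrow> ('k \<Rightarrow>\<^sub>0 complex)" where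
  "point x = Poly_Mapping.single x 1"

definition norm1 :: "('k \<Rightarrow>\<^sub>0 complex) \<Rightarrow> real" where
  "norm1 \<mu> = (\<Sum>x\<in>Poly_Mapping.keys \<mu>. cmod (Poly_Mapping.lookup \<mu> x))"

locale discrete_hypergroup =
  fixes K :: "'k set"
    and conv :: "('k \<Rightarrow>\<^sub>0 complex) \<Rightarrow> ('k \<Rightarrow>\<^sub>0 complex) \<Rightarrow> ('k \<Rightarrow>\<^sub>0 complex)"
    and star :: "('k \<Rightarrow>\<^sub>0 complex) \<Rightarrow> ('k \<Rightarrow>\<^sub>0 complex)"
    and e :: 'k
  assumes conv_closed:
      "\<lbrakk>\<mu> \<in> free_cspace K; \<nu> \<in> free_cspace K\<rbrakk> \<Longrightarrow> conv \<mu> \<nu> \<in> free_cspace K"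
    and conv_add_left:
      "\<lbrakk>\<mu> \<in> free_cspace K; \<mu>' \<in> free_cspace K; \<nu> \<in> free_cspace K\<rbrakk>
        \<Longrightarrow> conv (\<mu> + \<mu>') \<nu> = conv \<mu> \<nu> + conv \<mu>' \<nu>"
    and conv_add_right:
      "\<lbrakk>\<mu> \<in> free_cspace K; \<nu> \<in> free_cspace K; \<nu>' \<in> free_cspace K\<rbrakk>
        \<Longrightarrow> conv \<mu> (\<nu> + \<nu>') = conv \<mu> \<nu> + conv \<mu> \<nu>'"
    and conv_scale_left:
      "\<lbrakk>\<mu> \<in> free_cspace K; \<nu> \<in> free_cspace K\<rbrakk>
        \<Longrightarrow> conv (cscale c \<mu>) \<nu> = cscale c (conv \<mu> \<nu>)"
    and conv_scale_right:
      "\<lbrakk>\<mu> \<in> free_cspace K; \<nu> \<in> free_cspace K\<rbrakk>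
        \<Longrightarrow> conv \<mu> (cscale c \<nu>) = cscale c (conv \<mu> \<nu>)"
    and conv_assoc:
      "\<lbrakk>\<mu> \<in> free_cspace K; \<nu> \<in> free_cspace K; \<rho> \<in> free_cspace K\<rbrakk>
        \<Longrightarrow> conv (conv \<mu> \<nu>) \<rho> = conv \<mu> (conv \<nu> \<rho>)"
    and star_closed: "\<mu> \<in> free_cspace K \<Longrightarrow> star \<mu> \<in> free_cspace K"
    and star_add:
      "\<lbrakk>\<mu> \<in> free_cspace K; \<nu> \<in> free_cspace K\<rbrakk> \<Longrightarrow> star (\<mu> + \<nu>) = star \<mu> + star \<nu>"
    and star_scale: "\<mu> \<in> free_cspace K \<Longrightarrow> star (cscale c \<mu>) = cscale (cnj c) (star \<mu>)"
    and star_star: "\<mu> \<in> free_cspace K \<Longrightarrow> star (star \<mu>) = \<mu>"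
    and star_conv:
      "\<lbrakk>\<mu> \<in> free_cspace K; \<nu> \<in> free_cspace K\<rbrakk> \<Longrightarrow> star (conv \<mu> \<nu>) = conv (star \<nu>) (star \<mu>)"
    and neutral_in: "e \<in> K"
    and neutral_left: "\<mu> \<in> free_cspace K \<Longrightarrow> conv (point e) \<mu> = \<mu>"
    and neutral_right: "\<mu> \<in> free_cspace K \<Longrightarrow> conv \<mu> (point e) = \<mu>"
    and conv_nonneg:
      "\<lbrakk>x \<in> K; y \<in> K; z \<in> K\<rbrakk>
        \<Longrightarrow> Poly_Mapping.lookup (conv (point x) (point y)) z \<in> \<real>
          \<and> 0 \<le> Re (Poly_Mapping.lookup (conv (point x) (point y)) z)"
    and conv_norm1: "\<lbrakk>x \<in> K; y \<in> K\<rbrakk> \<Longrightarrow> norm1 (conv (point x) (point y)) = 1"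
    and star_onto: "star ` (point ` K) = point ` K"
    and neutral_in_supp:
      "\<lbrakk>x \<in> K; y \<in> K\<rbrakk>
        \<Longrightarrow> e \<in> Poly_Mapping.keys (conv (point x) (point y)) \<longleftrightarrow> point y = star (point x)"

locale hermitian_discrete_hypergroup = discrete_hypergroup +
  assumes hermitian: "x \<in> K \<Longrightarrow> star (point x) = point x"

section \<open>Graphs\<close>

definition adj :: "'a set set \<Rightarrow> ('a \<times> 'a) set" where
  "adj E = {(v, w). {v, w} \<in> E}"

locale lf_connected_graph =
  fixes V :: "'a set" and E :: "'a set set"
  assumes edges: "e \<in> E \<Longrightarrow> e \<subseteq> V \<and> card e = 2"
    and nonempty: "V \<noteq> {}"
    and connected: "\<lbrakk>v \<in> V; w \<in> V\<rbrakk> \<Longrightarrow> (v, w) \<in> (adj E)\<^sup>*"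
    and locally_finite: "v \<in> V \<Longrightarrow> finite {w. {v, w} \<in> E}"

text \<open>\<open>adj E ^^ n\<close> relates the endpoints of walks of length \<open>n\<close>.\<close>

definition gdist :: "'a set set \<Rightarrow> 'a \<Rightarrow> 'a \<Rightarrow> nat" where
  "gdist E v w = (LEAST n. (v, w) \<in> adj E ^^ n)"

definition gdiam :: "'a set \<Rightarrow> 'a set set \<Rightarrow> enat" where
  "gdiam V E = (SUP (v, w)\<in>V \<times> V. enat (gdist E v w))"

definition gsphere :: "'a set \<Rightarrow> 'a set set \<Rightarrow> nat \<Rightarrow> 'a \<Rightarrow> 'a set" where
  "gsphere V E i v = {w \<in> V. gdist E v w = i}"

definition gindex :: "'a set \<Rightarrow> 'a set set \<Rightarrow> nat set" where
  "gindex V E = {i. enat i \<le> gdiam V E}"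

definition grel :: "'a set \<Rightarrow> 'a set set \<Rightarrow> nat \<Rightarrow> ('a \<times> 'a) set" where
  "grel V E i = {(v, w) \<in> V \<times> V. gdist E v w = i}"

definition grels :: "'a set \<Rightarrow> 'a set set \<Rightarrow> ('a \<times> 'a) set set" where
  "grels V E = grel V E ` gindex V E"

text \<open>For the one-vertex graph (diameter 0) the ranges of \<open>b\<close> and \<open>c\<close> are empty; there
  \<open>b 0\<close> is unconstrained apart from \<open>b 0 = card {} = 0\<close>, so this graph is distance-regular.\<close>

definition distance_regular :: "'a set \<Rightarrow> 'a set set \<Rightarrow> bool" where
  "distance_regular V E \<longleftrightarrow> lf_connected_graph V E \<and>
    (\<exists>b c :: nat \<Rightarrow> nat.
      (\<forall>i. enat i < gdiam V E \<longrightarrow> 0 < b i) \<and>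
      (\<forall>i. 1 \<le> i \<and> enat i \<le> gdiam V E \<longrightarrow> 0 < c i) \<and>
      (\<forall>v\<in>V. card (gsphere V E 1 v) = b 0) \<and>
      (\<forall>i. 1 \<le> i \<and> enat i < gdiam V E \<longrightarrow>
        (\<forall>v\<in>V. \<forall>w\<in>V. gdist E v w = i \<longrightarrow>
          card (gsphere V E (i + 1) v \<inter> gsphere V E 1 w) = b i \<and>
          card (gsphere V E (i - 1) v \<inter> gsphere V E 1 w) = c i)) \<and>
      (\<forall>s. 1 \<le> s \<and> gdiam V E = enat s \<longrightarrow>
        (\<forall>v\<in>V. \<forall>w\<in>V. gdist E v w = s \<longrightarrow>
          card (gsphere V E (s - 1) v \<inter> gsphere V E 1 w) = c s)))"

section \<open>The convolution determined by a base point\<close>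

definition gcoeff :: "'a set \<Rightarrow> 'a set set \<Rightarrow> 'a \<Rightarrow> nat \<Rightarrow> nat \<Rightarrow> nat \<Rightarrow> real" where
  "gcoeff V E v0 i j k =
    1 / real (card (gsphere V E i v0)) *
      (\<Sum>v\<in>gsphere V E i v0.
        real (card (gsphere V E j v \<inter> gsphere V E k v0)) / real (card (gsphere V E j v)))"

text \<open>\<open>gindex V E\<close> may be infinite, and \<open>sum\<close> over an infinite set is 0; hence the restriction
  to the indices with nonzero coefficient.\<close>

definition gprod :: "'a set \<Rightarrow> 'a set set \<Rightarrow> 'a \<Rightarrow> nat \<Rightarrow> nat \<Rightarrow> (('a \<times> 'a) set \<Rightarrow>\<^sub>0 complex)" where
  "gprod V E v0 i j =
    (\<Sum>k | k \<in> gindex V E \<and> gcoeff V E v0 i j k \<noteq> 0.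
      cscale (complex_of_real (gcoeff V E v0 i j k)) (point (grel V E k)))"

text \<open>The bilinear extension of \<open>gprod\<close>; it relies on \<open>grel V E\<close> being injective on
  \<open>gindex V E\<close>, see \<open>inj_on_grel\<close> and \<open>gconv_point\<close> below.\<close>

definition gconv :: "'a set \<Rightarrow> 'a set set \<Rightarrow> 'a \<Rightarrow> (('a \<times> 'a) set \<Rightarrow>\<^sub>0 complex)
    \<Rightarrow> (('a \<times> 'a) set \<Rightarrow>\<^sub>0 complex) \<Rightarrow> (('a \<times> 'a) set \<Rightarrow>\<^sub>0 complex)" where
  "gconv V E v0 \<mu> \<nu> =
    (\<Sum>i | i \<in> gindex V E \<and> grel V E i \<in> Poly_Mapping.keys \<mu>.
      \<Sum>j | j \<in> gindex V E \<and> grel V E j \<in> Poly_Mapping.keys \<nu>.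
        cscale (Poly_Mapping.lookup \<mu> (grel V E i) * Poly_Mapping.lookup \<nu> (grel V E j))
          (gprod V E v0 i j))"

text \<open>The conjugate-linear map fixing every basis element.\<close>

definition conj_star :: "('k \<Rightarrow>\<^sub>0 complex) \<Rightarrow> ('k \<Rightarrow>\<^sub>0 complex)" where
  "conj_star \<mu> = Poly_Mapping.map cnj \<mu>"

lemma (in lf_connected_graph) grel_nonempty:
  assumes "i \<in> gindex V E"
  shows "grel V E i \<noteq> {}"
proof (cases i)
  case 0
  obtain v where v: "v \<in> V" using nonempty by blast
  have "gdist E v v = 0" unfolding gdist_def by (rule Least_eq_0) simp
  with v 0 show ?thesis by (auto simp: grel_def)
next
  case (Suc i')
  have "enat i' < gdiam V E"
    using assms Suc by (simp add: gindex_def Suc_ile_eq)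
  then obtain v w where vw: "v \<in> V" "w \<in> V" "i' < gdist E v w"
    unfolding gdiam_def less_SUP_iff by auto
  have "\<exists>n. (v, w) \<in> adj E ^^ n"
    using connected[OF vw(1,2)] by (rule rtrancl_imp_relpow)
  then have walk: "(v, w) \<in> adj E ^^ gdist E v w"
    unfolding gdist_def by (rule LeastI_ex)
  obtain m where m: "gdist E v w = i + m"
    using vw(3) Suc by (metis Suc_leI le_iff_add)
  from walk obtain u where u: "(v, u) \<in> adj E ^^ i" "(u, w) \<in> adj E ^^ m"
    unfolding m relpow_add by blast
  have "u \<in> V"
    using u(1) Suc edges by (auto simp: adj_def)
  have le: "gdist E v u \<le> i" unfolding gdist_def by (rule Least_le) (rule u(1))
  have "(v, u) \<in> adj E ^^ gdist E v u"
    unfolding gdist_def by (rule LeastI) (rule u(1))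
  then have "(v, w) \<in> adj E ^^ (gdist E v u + m)"
    using u(2) unfolding relpow_add by blast
  then have "gdist E v w \<le> gdist E v u + m"
    by (subst gdist_def) (rule Least_le)
  with le m have "gdist E v u = i" by simp
  with vw(1) \<open>u \<in> V\<close> show ?thesis by (auto simp: grel_def)
qed

lemma (in lf_connected_graph) inj_on_grel: "inj_on (grel V E) (gindex V E)"
proof (rule inj_onI)
  fix i j assume i: "i \<in> gindex V E" and eq: "grel V E i = grel V E j"
  from grel_nonempty[OF i] obtain v w where "(v, w) \<in> grel V E i" by fast
  then show "i = j" using eq by (auto simp: grel_def)
qed

lemma (in lf_connected_graph) gconv_point:
  assumes "i \<in> gindex V E" "j \<in> gindex V E"
  shows "gconv V E v0 (point (grel V E i)) (point (grel V E j)) = gprod V E v0 i j"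
proof -
  have *: "{i'. i' \<in> gindex V E \<and> grel V E i' \<in> Poly_Mapping.keys (point (grel V E l))} = {l}"
    if "l \<in> gindex V E" for l
    using that inj_on_grel by (auto simp: point_def inj_on_def)
  have "cscale 1 \<mu> = \<mu>" for \<mu> :: "('a \<times> 'a) set \<Rightarrow>\<^sub>0 complex"
    by (rule poly_mapping_eqI) (simp add: cscale_def Poly_Mapping.map.rep_eq when_def)
  then show ?thesis
    unfolding gconv_def *[OF assms(1)] *[OF assms(2)] by (simp add: point_def)
qed

end

theory Submission imports Defs
begin

text \<open>Distance-regularity says that the number of neighbours of \<open>w\<close> at distance \<open>m\<close> from \<open>v\<close>
  depends only on \<open>d(v, w)\<close>.  Counting pairs \<open>(x, y)\<close> with \<open>x\<close> a neighbour of \<open>w\<close>,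
  \<open>d(v, y) = i\<close> and \<open>d(x, y) = j\<close> in two ways propagates this by induction on \<open>j\<close> to all
  intersection numbers \<open>p i j k = card {x. d(v, x) = i \<and> d(w, x) = j}\<close>, where \<open>d(v, w) = k\<close>.  Then the coefficient
  \<open>P\<^sub>i\<^sub>j\<^sup>k\<close> equals \<open>p j k i / n\<^sub>j = n\<^sub>k p i j k / (n\<^sub>i n\<^sub>j)\<close> with \<open>n\<^sub>i\<close> the size of a sphere
  of radius \<open>i\<close>, independently of the base point.  Hence sending \<open>\<mu>\<close> to the matrix
  \<open>\<mu>(R\<^sub>d) / n\<^sub>d\<close>, \<open>d = d(v, w)\<close>, turns the convolution into the product of symmetric,
  row-finite matrices, from which all algebraic axioms are inherited.\<close>

section \<open>Graph distance\<close>

context lf_connected_graph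
begin

abbreviation d :: "'a \<Rightarrow> 'a \<Rightarrow> nat" where "d \<equiv> gdist E"
abbreviation S :: "nat \<Rightarrow> 'a \<Rightarrow> 'a set" where "S \<equiv> gsphere V E"

lemma relpow_gdist:
  assumes "v \<in> V" "w \<in> V"
  shows "(v, w) \<in> adj E ^^ d v w"
  unfolding gdist_def using rtrancl_imp_relpow[OF connected[OF assms]] by (rule LeastI_ex)

lemma gdist_le: "(v, w) \<in> adj E ^^ n \<Longrightarrow> d v w \<le> n"
  unfolding gdist_def by (rule Least_le)

lemma gdist_self [simp]: "d v v = 0"
  using gdist_le[of v v 0] by simp

lemma gdist_eq_0_iff: "v \<in> V \<Longrightarrow> w \<in> V \<Longrightarrow> d v w = 0 \<longleftrightarrow> v = w"
  using relpow_gdist[of v w] by auto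

lemma relpow_adj_sym: "(v, w) \<in> adj E ^^ n \<Longrightarrow> (w, v) \<in> adj E ^^ n"
proof (induction n arbitrary: w)
  case (Suc n)
  then obtain u where "(v, u) \<in> adj E ^^ n" "(u, w) \<in> adj E" by auto
  then show ?case
    using Suc.IH[of u] by (intro relpow_Suc_I2[of w u]) (auto simp: adj_def insert_commute)
qed simp

lemma gdist_sym: "v \<in> V \<Longrightarrow> w \<in> V \<Longrightarrow> d v w = d w v"
  using gdist_le[OF relpow_adj_sym[OF relpow_gdist]] by (intro antisym)

lemma gdist_triangle:
  assumes "u \<in> V" "v \<in> V" "w \<in> V"
  shows "d u w \<le> d u v + d v w"
  using relpow_gdist[of u v] relpow_gdist[of v w] assms
  by (intro gdist_le) (auto simp: relpow_add)

text \<open>The witness is the penultimate vertex of a shortest walk; the triangle inequality turns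
  the bounds \<open>d v u \<le> n\<close> and \<open>d u w \<le> 1\<close> into equalities.\<close>

lemma gdist_SucE:
  assumes "v \<in> V" "w \<in> V" "d v w = Suc n"
  obtains u where "u \<in> V" "d v u = n" "d u w = 1" "(u, w) \<in> adj E"
proof -
  from relpow_gdist[OF assms(1,2)] assms(3)
  obtain u where u: "(v, u) \<in> adj E ^^ n" "(u, w) \<in> adj E" by auto
  from u(2) have uV: "u \<in> V" using edges by (auto simp: adj_def)
  have "d v u \<le> n" "d u w \<le> 1" using gdist_le u gdist_le[of u w 1] by auto
  with gdist_triangle[of v u w] assms uV have "d v u = n" "d u w = 1" by auto
  with that uV u(2) show thesis by blast
qed

lemma mem_gsphere_iff: "x \<in> S i v \<longleftrightarrow> x \<in> V \<and> d v x = i"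
  by (simp add: gsphere_def)

lemma gsphere_0: "v \<in> V \<Longrightarrow> S 0 v = {v}"
  using gdist_eq_0_iff by (auto simp: mem_gsphere_iff)

text \<open>Local finiteness propagates outwards: a shortest walk to the next sphere passes through
  the current one.\<close>

lemma finite_gsphere: "v \<in> V \<Longrightarrow> finite (S i v)"
proof (induction i)
  case 0
  then show ?case by (simp add: gsphere_0)
next
  case (Suc i)
  have "S (Suc i) v \<subseteq> (\<Union>u\<in>S i v. {w. {u, w} \<in> E})"
  proof
    fix w assume "w \<in> S (Suc i) v"
    then have "w \<in> V" "d v w = Suc i" by (auto simp: mem_gsphere_iff)
    from gdist_SucE[OF Suc.prems this] show "w \<in> (\<Union>u\<in>S i v. {w. {u, w} \<in> E})"
      by (fastforce simp: mem_gsphere_iff adj_def)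
  qed
  moreover have "finite (\<Union>u\<in>S i v. {w. {u, w} \<in> E})"
    using Suc locally_finite by (auto simp: mem_gsphere_iff)
  ultimately show ?case by (rule finite_subset)
qed

lemma gdist_in_gindex:
  assumes "v \<in> V" "w \<in> V"
  shows "d v w \<in> gindex V E"
  unfolding gindex_def gdiam_def using assms by (auto intro!: SUP_upper2[of "(v, w)"])

lemma zero_in_gindex: "0 \<in> gindex V E"
  by (simp add: gindex_def flip: zero_enat_def)

lemma gindex_gdistE:
  assumes "i \<in> gindex V E"
  obtains v w where "v \<in> V" "w \<in> V" "d v w = i"
  using grel_nonempty[OF assms] by (auto simp: grel_def)

lemma gsphere_neighbour_cases:
  assumes "v \<in> V" "w \<in> V" "x \<in> S m v \<inter> S 1 w"
  shows "m \<le> Suc (d v w)" "d v w \<le> Suc m"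
  using assms gdist_triangle[of v w x] gdist_triangle[of v x w] gdist_sym[of w x]
  by (auto simp: mem_gsphere_iff)

section \<open>Intersection numbers\<close>

text \<open>For \<open>v \<noteq> w\<close>, a neighbour of \<open>w\<close> is one step farther
  from \<open>v\<close>, one step nearer or equally far. The parameters give the first two counts,
  and the valency \<open>b 0\<close> gives the third by subtraction.\<close>

lemma one_step_intersection_numbers:
  assumes "distance_regular V E"
  obtains t where "\<And>m v w. v \<in> V \<Longrightarrow> w \<in> V \<Longrightarrow> card (S m v \<inter> S 1 w) = t m (d v w)"
proof -
  from assms obtain b c where
    bc: "\<forall>i. 1 \<le> i \<and> enat i < gdiam V E \<longrightarrow> (\<forall>v\<in>V. \<forall>w\<in>V. d v w = i \<longrightarrow>
      card (S (i + 1) v \<inter> S 1 w) = b i \<and> card (S (i - 1) v \<inter> S 1 w) = c i)"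
    and cs: "\<forall>s. 1 \<le> s \<and> gdiam V E = enat s \<longrightarrow> (\<forall>v\<in>V. \<forall>w\<in>V. d v w = s \<longrightarrow>
      card (S (s - 1) v \<inter> S 1 w) = c s)"
    and b0: "\<forall>v\<in>V. card (S 1 v) = b 0"
    unfolding distance_regular_def by (elim conjE exE) (rule that)
  \<comment> \<open>At the diameter the outward count is 0, which the value of \<open>b\<close>
    there need not reflect.\<close>
  define b' where "b' k = (if enat k < gdiam V E then b k else 0)" for k
  define t where "t m k = (if k = 0 then if m = 1 then b 0 else 0
      else if m = k + 1 then b' k else if m = k - 1 then c k
      else if m = k then b 0 - b' k - c k else 0)" for m k :: nat
  show thesis
  proof (rule that[of t])
    fix m v w assume vw: "v \<in> V" "w \<in> V"
    define k where "k = d v w"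
    show "card (S m v \<inter> S 1 w) = t m (d v w)"
    proof (cases "k = 0")
      case True
      then have "v = w" using gdist_eq_0_iff[OF vw] by (simp add: k_def)
      then have "S m v \<inter> S 1 w = (if m = 1 then S 1 v else {})"
        by (auto simp: mem_gsphere_iff)
      then show ?thesis using bspec[OF b0 vw(1)] \<open>v = w\<close> by (simp add: t_def)
    next
      case False
      have kd: "enat k \<le> gdiam V E" using gdist_in_gindex[OF vw] by (simp add: gindex_def k_def)
      have k: "1 \<le> k" using False by simp
      note inner = bc[rule_format, OF conjI[OF k] vw k_def[symmetric]]
      note outer = cs[rule_format, OF conjI[OF k] vw k_def[symmetric]]
      have up: "card (S (k + 1) v \<inter> S 1 w) = b' k"
      proof (cases "enat k < gdiam V E")
        case True
        then show ?thesis using inner by (simp add: b'_def)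
      next
        case *: False
        with kd have "gdiam V E = enat k" by simp
        then have "S (k + 1) v = {}"
          using gdist_in_gindex[OF vw(1)] by (fastforce simp: mem_gsphere_iff gindex_def)
        then show ?thesis using * by (simp add: b'_def)
      qed
      have down: "card (S (k - 1) v \<inter> S 1 w) = c k"
      proof (cases "enat k < gdiam V E")
        case True
        then show ?thesis using inner by simp
      next
        case False
        with kd have "gdiam V E = enat k" by simp
        then show ?thesis by (rule outer)
      qed
      have split: "S 1 w = (S (k + 1) v \<inter> S 1 w) \<union> (S (k - 1) v \<inter> S 1 w) \<union> (S k v \<inter> S 1 w)"
      proof (intro subset_antisym subsetI)
        fix x assume x: "x \<in> S 1 w"
        then have "d v x = k + 1 \<or> d v x = k - 1 \<or> d v x = k"
          using gsphere_neighbour_cases[OF vw, of x "d v x"]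
          by (auto simp: mem_gsphere_iff k_def)
        with x show "x \<in> (S (k + 1) v \<inter> S 1 w) \<union> (S (k - 1) v \<inter> S 1 w) \<union> (S k v \<inter> S 1 w)"
          by (auto simp: mem_gsphere_iff)
      qed auto
      \<comment> \<open>As \<open>k \<noteq> 0\<close>, the distances \<open>k + 1\<close>,
        \<open>k - 1\<close> and \<open>k\<close> are distinct despite truncated subtraction, so the
        three pieces are disjoint.\<close>
      have "card (S 1 w) = card (S (k + 1) v \<inter> S 1 w) + card (S (k - 1) v \<inter> S 1 w)
          + card (S k v \<inter> S 1 w)"
        using False vw finite_gsphere
        by (subst split, subst card_Un_disjoint, simp, simp, force simp: mem_gsphere_iff,
            subst card_Un_disjoint) (auto simp: mem_gsphere_iff)
      then have stay: "card (S k v \<inter> S 1 w) = b 0 - b' k - c k"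
        using up down bspec[OF b0 vw(2)] by simp
      have other: "S m v \<inter> S 1 w = {}" if "m \<noteq> k + 1" "m \<noteq> k - 1" "m \<noteq> k"
        using gsphere_neighbour_cases[OF vw, of _ m] that unfolding k_def by fastforce
      show ?thesis
        using up down stay other False by (auto simp: t_def simp flip: k_def)
    qed
  qed
qed

text \<open>Both sides count the pairs \<open>(x, y)\<close> with \<open>d w x = k\<close>,
  \<open>d v y = i\<close> and \<open>d x y = j\<close>.\<close>

lemma sum_card_Int_swap:
  assumes "v \<in> V" "w \<in> V"
  shows "(\<Sum>x\<in>S k w. card (S i v \<inter> S j x)) = (\<Sum>y\<in>S i v. card (S j y \<inter> S k w))"
proof -
  have "(\<Sum>x\<in>S k w. card (S i v \<inter> S j x)) = (\<Sum>x\<in>S k w. \<Sum>y\<in>{y \<in> S i v. d x y = j}. 1)"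
    by (intro sum.cong) (auto simp: mem_gsphere_iff intro!: arg_cong[of _ _ card])
  also have "\<dots> = (\<Sum>y\<in>S i v. \<Sum>x\<in>{x \<in> S k w. d x y = j}. 1)"
    using assms by (intro sum.swap_restrict finite_gsphere)
  also have "\<dots> = (\<Sum>y\<in>S i v. card (S j y \<inter> S k w))"
    using gdist_sym by (intro sum.cong) (auto simp: mem_gsphere_iff intro!: arg_cong[of _ _ card])
  finally show ?thesis .
qed

text \<open>In the double count with \<open>x\<close> a neighbour of \<open>w\<close> and
  \<open>d x y = j - 1\<close>, one side is known by induction. The other consists of known terms
  for radii below \<open>j\<close> and the wanted count times \<open>t (j - 1) j\<close>, a factor
  that is nonzero whenever the count is.\<close>

lemma intersection_numbers:
  assumes "distance_regular V E"
  shows "\<exists>p. \<forall>i. \<forall>v\<in>V. \<forall>w\<in>V. card (S i v \<inter> S j w) = p i (d v w)"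
proof (induction j rule: less_induct)
  case (less j)
  from one_step_intersection_numbers[OF assms] obtain t where
    t: "\<And>m v w. v \<in> V \<Longrightarrow> w \<in> V \<Longrightarrow> card (S m v \<inter> S 1 w) = t m (d v w)"
    by blast
  show ?case
  proof (cases j)
    case 0
    have "S i v \<inter> S 0 w = (if d v w = i then {w} else {})" if "v \<in> V" "w \<in> V" for i v w
      using that by (auto simp: gsphere_0 mem_gsphere_iff)
    then show ?thesis
      unfolding 0 by (intro exI[of _ "\<lambda>i k. if k = i then 1 else 0"]) simp
  next
    case (Suc j')
    from less.IH have "\<forall>l\<in>{..j'}. \<exists>g. \<forall>i. \<forall>v\<in>V. \<forall>w\<in>V. card (S i v \<inter> S l w) = g i (d v w)"
      by (simp add: Suc)
    from bchoice[OF this] obtain g where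
      g: "\<And>l i v w. l \<le> j' \<Longrightarrow> v \<in> V \<Longrightarrow> w \<in> V \<Longrightarrow> card (S i v \<inter> S l w) = g l i (d v w)"
      by auto
    \<comment> \<open>The recursion solved for the wanted count. The subtraction is exact, and so is
      the division when the divisor is nonzero. Neighbours of \<open>w\<close> have distance at most
      \<open>Suc (d v w)\<close> from \<open>v\<close>, which bounds \<open>m\<close>.\<close>
    have "card (S i v \<inter> S j w) =
        ((\<Sum>m\<le>Suc (d v w). t m (d v w) * g j' i m) - (\<Sum>l\<le>j'. t j' l * g l i (d v w)))
          div t j' j"
      if vw: "v \<in> V" "w \<in> V" for i v w
    proof -
      have "(\<Sum>x\<in>S 1 w. card (S i v \<inter> S j' x)) = (\<Sum>x\<in>S 1 w. g j' i (d v x))"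
        using vw by (intro sum.cong) (auto simp: g mem_gsphere_iff)
      also have "\<dots> = (\<Sum>m\<le>Suc (d v w). \<Sum>x\<in>{x \<in> S 1 w. d v x = m}. g j' i (d v x))"
        using vw gsphere_neighbour_cases(1)[OF vw]
        by (intro sum.group[symmetric] finite_gsphere) (auto simp: mem_gsphere_iff)
      also have "\<dots> = (\<Sum>m\<le>Suc (d v w). t m (d v w) * g j' i m)"
      proof (intro sum.cong refl)
        fix m
        have "(\<Sum>x\<in>{x \<in> S 1 w. d v x = m}. g j' i (d v x)) = (\<Sum>x\<in>S m v \<inter> S 1 w. g j' i m)"
          by (intro sum.cong) (auto simp: mem_gsphere_iff)
        then show "(\<Sum>x\<in>{x \<in> S 1 w. d v x = m}. g j' i (d v x)) = t m (d v w) * g j' i m"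
          using t[OF vw, of m] by (simp del: One_nat_def)
      qed
      finally have L: "(\<Sum>x\<in>S 1 w. card (S i v \<inter> S j' x)) = \<dots>" .
      \<comment> \<open>A vertex \<open>y\<close> contributes only if it has distance
        \<open>j'\<close> to some neighbour of \<open>w\<close>, hence only if
        \<open>d y w \<le> Suc j'\<close>, which is \<open>j\<close>.\<close>
      have "(\<Sum>y\<in>S i v. card (S j' y \<inter> S 1 w))
          = (\<Sum>y\<in>{y \<in> S i v. d y w \<le> j}. card (S j' y \<inter> S 1 w))"
      proof (intro sum.mono_neutral_right ballI)
        fix y assume "y \<in> S i v - {y \<in> S i v. d y w \<le> j}"
        then have "S j' y \<inter> S 1 w = {}"
          using gsphere_neighbour_cases(2)[of y w _ j'] vw Suc by (fastforce simp: mem_gsphere_iff)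
        then show "card (S j' y \<inter> S 1 w) = 0" by simp
      qed (use vw finite_gsphere in auto)
      also have "\<dots> = (\<Sum>y\<in>{y \<in> S i v. d y w \<le> j}. t j' (d y w))"
        using vw by (intro sum.cong) (auto simp: t mem_gsphere_iff simp del: One_nat_def)
      also have "\<dots> = (\<Sum>l\<le>j. \<Sum>y\<in>{y \<in> {y \<in> S i v. d y w \<le> j}. d y w = l}. t j' (d y w))"
        using vw by (intro sum.group[symmetric]) (auto simp: finite_gsphere)
      also have "\<dots> = (\<Sum>l\<le>j. t j' l * card (S i v \<inter> S l w))"
      proof (intro sum.cong refl)
        fix l assume "l \<in> {..j}"
        then have "(\<Sum>y\<in>{y \<in> {y \<in> S i v. d y w \<le> j}. d y w = l}. t j' (d y w))
            = (\<Sum>y\<in>S i v \<inter> S l w. t j' l)"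
          using vw gdist_sym[of _ w] by (intro sum.cong) (auto simp: mem_gsphere_iff)
        then show "(\<Sum>y\<in>{y \<in> {y \<in> S i v. d y w \<le> j}. d y w = l}. t j' (d y w))
            = t j' l * card (S i v \<inter> S l w)"
          by auto
      qed
      also have "\<dots> = (\<Sum>l\<le>j'. t j' l * g l i (d v w)) + t j' j * card (S i v \<inter> S j w)"
        using vw by (simp add: Suc g)
      finally have R: "t j' j * card (S i v \<inter> S j w) =
          (\<Sum>m\<le>Suc (d v w). t m (d v w) * g j' i m) - (\<Sum>l\<le>j'. t j' l * g l i (d v w))"
        using L sum_card_Int_swap[OF vw, of i j' 1] by (simp del: One_nat_def)
      \<comment> \<open>Division by 0 yields 0, so the count must vanish here. Otherwise the
        penultimate vertex of a shortest walk from a counted \<open>y\<close> to \<open>w\<close>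
        would make \<open>t j' j\<close> positive.\<close>
      have "S i v \<inter> S j w = {}" if "t j' j = 0"
      proof (rule ccontr)
        assume "S i v \<inter> S j w \<noteq> {}"
        then obtain y where y: "y \<in> V" "d y w = Suc j'"
          using vw gdist_sym Suc by (auto simp: mem_gsphere_iff)
        from gdist_SucE[OF y(1) vw(2) y(2)] obtain u where "u \<in> S j' y \<inter> S 1 w"
          using vw gdist_sym by (metis IntI mem_gsphere_iff)
        then have "card (S j' y \<inter> S 1 w) \<noteq> 0"
          using finite_gsphere[OF vw(2)] by auto
        then show False using t[OF y(1) vw(2)] y(2) that Suc by (simp del: One_nat_def)
      qed
      then show ?thesis
        unfolding R[symmetric] by (cases "t j' j = 0") auto
    qed
    then show ?thesis
      by (intro exI[of _ "\<lambda>i k. ((\<Sum>m\<le>Suc k. t m k * g j' i m) - (\<Sum>l\<le>j'. t j' l * g l i k))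
          div t j' j"]) simp
  qed
qed

end

section \<open>The matrix representation\<close>

lemma lookup_cscale: "Poly_Mapping.lookup (cscale c \<mu>) x = c * Poly_Mapping.lookup \<mu> x"
  by (simp add: cscale_def Poly_Mapping.map.rep_eq when_def)

lemma lookup_conj_star: "Poly_Mapping.lookup (conj_star \<mu>) x = cnj (Poly_Mapping.lookup \<mu> x)"
  by (simp add: conj_star_def Poly_Mapping.map.rep_eq when_def)

lemma lookup_point: "Poly_Mapping.lookup (point x) y = (if x = y then 1 else 0)"
  by (simp add: point_def lookup_single when_def)

lemma point_eq_iff: "point x = point y \<longleftrightarrow> x = y"
  by (metis lookup_point zero_neq_one)

lemma free_cspace_iff: "\<mu> \<in> free_cspace K \<longleftrightarrow> (\<forall>x. x \<notin> K \<longrightarrow> Poly_Mapping.lookup \<mu> x = 0)"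
  unfolding free_cspace_def by (auto simp: in_keys_iff)

lemma free_cspace_add:
  "\<mu> \<in> free_cspace K \<Longrightarrow> \<nu> \<in> free_cspace K \<Longrightarrow> \<mu> + \<nu> \<in> free_cspace K"
  by (simp add: free_cspace_iff lookup_add)

lemma free_cspace_cscale: "\<mu> \<in> free_cspace K \<Longrightarrow> cscale c \<mu> \<in> free_cspace K"
  by (simp add: free_cspace_iff lookup_cscale)

lemma free_cspace_conj_star: "\<mu> \<in> free_cspace K \<Longrightarrow> conj_star \<mu> \<in> free_cspace K"
  by (simp add: free_cspace_iff lookup_conj_star)

lemma conj_star_point: "conj_star (point x) = point x"
  by (rule poly_mapping_eqI) (simp add: lookup_conj_star lookup_point)

section \<open>Structure constants in terms of intersection numbers\<close>

locale graph_with_intersection_numbers = lf_connected_graph +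
  fixes p :: "nat \<Rightarrow> nat \<Rightarrow> nat \<Rightarrow> nat"
  assumes card_Int: "\<lbrakk>v \<in> V; w \<in> V\<rbrakk> \<Longrightarrow> card (S i v \<inter> S j w) = p i j (d v w)"
begin

text \<open>The size of a sphere of radius \<open>i\<close>: for \<open>v = w\<close> and equal
  radii the intersection is the sphere itself.\<close>

abbreviation n :: "nat \<Rightarrow> nat" where "n i \<equiv> p i i 0"

lemma card_gsphere: "v \<in> V \<Longrightarrow> card (S i v) = n i"
  using card_Int[of v v i i] by simp

text \<open>One pair at distance \<open>i\<close> makes one sphere nonempty, and all spheres of
  radius \<open>i\<close> have the same size. Hence the denominators of the convolution do not
  vanish.\<close>

lemma n_pos:
  assumes "i \<in> gindex V E"
  shows "0 < n i"
proof -
  from assms obtain v w where "v \<in> V" "w \<in> S i v"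
    using gindex_gdistE by (metis mem_gsphere_iff)
  then show ?thesis
    using finite_gsphere card_gsphere by (metis card_gt_0_iff empty_iff)
qed

text \<open>Every \<open>v\<close> in the sphere contributes the same term, so the average equals
  that term and the base point disappears.\<close>

lemma gcoeff_eq:
  assumes "v0 \<in> V" "i \<in> gindex V E"
  shows "gcoeff V E v0 i j k = real (p j k i) / real (n j)"
proof -
  have "(\<Sum>v\<in>S i v0. real (card (S j v \<inter> S k v0)) / real (card (S j v)))
      = (\<Sum>v\<in>S i v0. real (p j k i) / real (n j))"
    using assms gdist_sym
    by (intro sum.cong) (auto simp: mem_gsphere_iff card_Int card_gsphere)
  then show ?thesis
    using n_pos[OF assms(2)] by (simp add: gcoeff_def card_gsphere assms)
qed

text \<open>Triangles with a corner \<open>v0\<close> and side lengths \<open>i\<close>,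
  \<open>j\<close>, \<open>k\<close>, counted from either of the other two corners.\<close>

lemma n_mult_p: "n i * p j k i = n k * p i j k"
proof -
  obtain v0 where v0: "v0 \<in> V" using nonempty by blast
  have "(\<Sum>y\<in>S i v0. card (S j y \<inter> S k v0)) = (\<Sum>y\<in>S i v0. p j k i)"
    using v0 gdist_sym by (intro sum.cong) (auto simp: mem_gsphere_iff card_Int)
  moreover have "(\<Sum>x\<in>S k v0. card (S i v0 \<inter> S j x)) = (\<Sum>x\<in>S k v0. p i j k)"
    using v0 by (intro sum.cong) (auto simp: mem_gsphere_iff card_Int)
  ultimately show ?thesis
    using sum_card_Int_swap[OF v0 v0, of i j k] by (simp add: card_gsphere v0)
qed

text \<open>The form suited to matrices: \<open>n k\<close> cancels the normalisation in
  \<open>kern\<close>, and \<open>p i j k\<close> counts intermediate vertices for a pair at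
  distance \<open>k\<close>.\<close>

lemma gcoeff_eq':
  assumes "v0 \<in> V" "i \<in> gindex V E" "j \<in> gindex V E"
  shows "gcoeff V E v0 i j k = real (n k) * real (p i j k) / (real (n i) * real (n j))"
  using n_pos[OF assms(2)] n_pos[OF assms(3)] n_mult_p[of i j k]
  by (simp add: gcoeff_eq assms field_simps flip: of_nat_mult)

text \<open>For \<open>d v w = i\<close>, a nonzero coefficient exhibits a vertex of the finite
  sphere \<open>S j v\<close> at distance \<open>k\<close> from \<open>w\<close>.\<close>

lemma finite_gcoeff_support:
  assumes "v0 \<in> V" "i \<in> gindex V E"
  shows "finite {k \<in> gindex V E. gcoeff V E v0 i j k \<noteq> 0}"
proof -
  obtain v w where vw: "v \<in> V" "w \<in> V" "d v w = i" using gindex_gdistE[OF assms(2)] .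
  have "{k \<in> gindex V E. gcoeff V E v0 i j k \<noteq> 0} \<subseteq> d w ` S j v"
  proof
    fix k assume "k \<in> {k \<in> gindex V E. gcoeff V E v0 i j k \<noteq> 0}"
    then have "card (S j v \<inter> S k w) \<noteq> 0" by (simp add: gcoeff_eq assms card_Int vw)
    then have "S j v \<inter> S k w \<noteq> {}" by force
    then show "k \<in> d w ` S j v" by (auto simp: mem_gsphere_iff)
  qed
  then show ?thesis by (rule finite_subset) (simp add: finite_gsphere vw)
qed

lemma lookup_gprod:
  assumes "v0 \<in> V" "i \<in> gindex V E" "k \<in> gindex V E"
  shows "Poly_Mapping.lookup (gprod V E v0 i j) (grel V E k) = of_real (gcoeff V E v0 i j k)"
proof -
  have "Poly_Mapping.lookup (gprod V E v0 i j) (grel V E k)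
      = (\<Sum>l | l \<in> gindex V E \<and> gcoeff V E v0 i j l \<noteq> 0.
          if l = k then of_real (gcoeff V E v0 i j l) else 0)"
    unfolding gprod_def lookup_sum
    by (intro sum.cong) (use assms inj_on_grel in \<open>auto simp: lookup_cscale lookup_point inj_on_def\<close>)
  then show ?thesis
    using assms finite_gcoeff_support[OF assms(1,2)] by simp
qed

lemma gprod_in_free_cspace: "gprod V E v0 i j \<in> free_cspace (grels V E)"
  unfolding free_cspace_iff gprod_def lookup_sum
  by (auto simp: lookup_cscale lookup_point grels_def intro!: sum.neutral)

lemma gconv_in_free_cspace: "gconv V E v0 \<mu> \<nu> \<in> free_cspace (grels V E)"
  using gprod_in_free_cspace unfolding free_cspace_iff gconv_def lookup_sum
  by (auto simp: lookup_cscale intro!: sum.neutral)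

section \<open>Formal sums as matrices: \<open>R_i\<close> becomes the transition matrix of a
  uniform jump to distance \<open>i\<close>\<close>

definition kern :: "(('a \<times> 'a) set \<Rightarrow>\<^sub>0 complex) \<Rightarrow> 'a \<Rightarrow> 'a \<Rightarrow> complex" where
  "kern \<mu> v w = Poly_Mapping.lookup \<mu> (grel V E (d v w)) / of_nat (n (d v w))"

text \<open>The support of a row of \<open>kern \<mu>\<close>. Matrix products are summed over such
  finite sets since \<open>V\<close> may be infinite, where \<open>sum\<close> would return
  0.\<close>

definition row :: "(('a \<times> 'a) set \<Rightarrow>\<^sub>0 complex) \<Rightarrow> 'a \<Rightarrow> 'a set" where
  "row \<mu> v = {x \<in> V. grel V E (d v x) \<in> Poly_Mapping.keys \<mu>}"

text \<open>The representation is faithful: every index is a realised distance with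
  \<open>n k > 0\<close>, so the entries determine the coefficients.\<close>

lemma kern_eqI:
  assumes "\<mu> \<in> free_cspace (grels V E)" "\<nu> \<in> free_cspace (grels V E)"
    and "\<And>v w. v \<in> V \<Longrightarrow> w \<in> V \<Longrightarrow> kern \<mu> v w = kern \<nu> v w"
  shows "\<mu> = \<nu>"
proof (rule poly_mapping_eqI)
  fix x
  show "Poly_Mapping.lookup \<mu> x = Poly_Mapping.lookup \<nu> x"
  proof (cases "x \<in> grels V E")
    case True
    then obtain k where k: "k \<in> gindex V E" "x = grel V E k" by (auto simp: grels_def)
    obtain v w where "v \<in> V" "w \<in> V" "d v w = k" using gindex_gdistE[OF k(1)] .
    then show ?thesis using assms(3)[of v w] n_pos[OF k(1)] k by (simp add: kern_def)
  next
    case False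
    then show ?thesis using assms by (simp add: free_cspace_iff)
  qed
qed

lemma kern_sym: "v \<in> V \<Longrightarrow> w \<in> V \<Longrightarrow> kern \<mu> v w = kern \<mu> w v"
  by (simp add: kern_def gdist_sym)

lemma kern_add: "kern (\<mu> + \<nu>) v w = kern \<mu> v w + kern \<nu> v w"
  by (simp add: kern_def lookup_add add_divide_distrib)

lemma kern_cscale: "kern (cscale c \<mu>) v w = c * kern \<mu> v w"
  by (simp add: kern_def lookup_cscale)

lemma kern_conj_star: "kern (conj_star \<mu>) v w = cnj (kern \<mu> v w)"
  by (simp add: kern_def lookup_conj_star)

lemma kern_outside_row: "x \<in> V - row \<mu> v \<Longrightarrow> kern \<mu> v x = 0"
  by (simp add: kern_def row_def in_keys_iff)

lemma finite_indices: "finite {i \<in> gindex V E. grel V E i \<in> Poly_Mapping.keys \<mu>}"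
  by (rule finite_imageD[of "grel V E"])
     (auto intro: finite_subset[of _ "Poly_Mapping.keys \<mu>"] inj_on_subset[OF inj_on_grel])

lemma row_subset: "row \<mu> v \<subseteq> V"
  by (auto simp: row_def)

lemma finite_row:
  assumes "v \<in> V"
  shows "finite (row \<mu> v)"
proof -
  have "row \<mu> v \<subseteq> (\<Union>i\<in>{i \<in> gindex V E. grel V E i \<in> Poly_Mapping.keys \<mu>}. S i v)"
    using gdist_in_gindex[OF assms] by (auto simp: row_def mem_gsphere_iff)
  then show ?thesis
    by (rule finite_subset) (use assms finite_indices finite_gsphere in blast)
qed

text \<open>Convolution becomes matrix multiplication: \<open>p i j k\<close> counts the
  intermediate vertices \<open>x\<close>, so the sum over \<open>i\<close> and \<open>j\<close>
  turns into a sum over \<open>x\<close> in which only \<open>i = d v x\<close> and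
  \<open>j = d x w\<close> survive.\<close>

lemma kern_gconv_row:
  assumes "v0 \<in> V" "v \<in> V" "w \<in> V"
  shows "kern (gconv V E v0 \<mu> \<nu>) v w = (\<Sum>x\<in>row \<mu> v. kern \<mu> v x * kern \<nu> x w)"
proof -
  define A where "A = {i \<in> gindex V E. grel V E i \<in> Poly_Mapping.keys \<mu>}"
  define B where "B = {j \<in> gindex V E. grel V E j \<in> Poly_Mapping.keys \<nu>}"
  define k where "k = d v w"
  define f where "f i = Poly_Mapping.lookup \<mu> (grel V E i) / of_nat (n i)" for i
  define g where "g j = Poly_Mapping.lookup \<nu> (grel V E j) / of_nat (n j)" for j
  have fin: "finite A" "finite B" using finite_indices by (auto simp: A_def B_def)
  have k: "k \<in> gindex V E" using gdist_in_gindex assms k_def by blast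
  \<comment> \<open>For \<open>i\<close> in \<open>A\<close> the whole sphere \<open>S i v\<close>
    lies in the row, so no intermediate vertex is lost.\<close>
  have p: "of_nat (p i j k) = (\<Sum>x\<in>row \<mu> v. of_bool (d v x = i) * of_bool (d x w = j) :: complex)"
    if "i \<in> A" for i j
  proof -
    have "S i v \<inter> S j w = {x \<in> row \<mu> v. d v x = i \<and> d x w = j}"
      using that assms gdist_sym by (auto simp: mem_gsphere_iff row_def A_def)
    then have "p i j k = card {x \<in> row \<mu> v. d v x = i \<and> d x w = j}"
      using card_Int[OF assms(2,3), of i j] by (simp add: k_def)
    then show ?thesis
      using finite_row[OF assms(2)]
      by (simp add: Int_def flip: of_bool_conj)
  qed
  have "kern (gconv V E v0 \<mu> \<nu>) v w
      = (\<Sum>i\<in>A. \<Sum>j\<in>B. Poly_Mapping.lookup \<mu> (grel V E i) * Poly_Mapping.lookup \<nu> (grel V E j)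
          * of_real (gcoeff V E v0 i j k)) / of_nat (n k)"
    unfolding kern_def gconv_def lookup_sum k_def[symmetric] A_def B_def
    by (intro arg_cong2[of _ _ _ _ "(/)"] sum.cong refl) (simp_all add: lookup_cscale lookup_gprod assms k)
  also have "\<dots> = (\<Sum>i\<in>A. \<Sum>j\<in>B. f i * g j * of_nat (p i j k))"
    unfolding sum_divide_distrib using n_pos[OF k]
    by (intro sum.cong refl) (simp add: gcoeff_eq' assms A_def B_def f_def g_def)
  also have "\<dots> = (\<Sum>i\<in>A. \<Sum>j\<in>B. \<Sum>x\<in>row \<mu> v.
      (f i * of_bool (d v x = i)) * (g j * of_bool (d x w = j)))"
    by (intro sum.cong refl) (simp add: p sum_distrib_left mult_ac)
  also have "\<dots> = (\<Sum>i\<in>A. \<Sum>x\<in>row \<mu> v. \<Sum>j\<in>B.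
      (f i * of_bool (d v x = i)) * (g j * of_bool (d x w = j)))"
    by (intro sum.cong refl sum.swap)
  also have "\<dots> = (\<Sum>x\<in>row \<mu> v. \<Sum>i\<in>A. \<Sum>j\<in>B.
      (f i * of_bool (d v x = i)) * (g j * of_bool (d x w = j)))"
    by (rule sum.swap)
  also have "\<dots> = (\<Sum>x\<in>row \<mu> v. (\<Sum>i\<in>A. f i * of_bool (d v x = i)) *
      (\<Sum>j\<in>B. g j * of_bool (d x w = j)))"
    by (simp add: sum_product)
  also have "\<dots> = (\<Sum>x\<in>row \<mu> v. kern \<mu> v x * kern \<nu> x w)"
  proof (intro sum.cong refl arg_cong2[of _ _ _ _ "(*)"])
    fix x assume "x \<in> row \<mu> v"
    then have x: "x \<in> V" by (simp add: row_def)
    have "d v x \<in> gindex V E" "d x w \<in> gindex V E" using gdist_in_gindex x assms by auto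
    \<comment> \<open>A distance outside \<open>A\<close> or \<open>B\<close> has coefficient 0, so
      the indicator sums give the matrix entries in every case.\<close>
    then have "d v x \<notin> A \<Longrightarrow> f (d v x) = 0" "d x w \<notin> B \<Longrightarrow> g (d x w) = 0"
      by (auto simp: A_def B_def f_def g_def in_keys_iff)
    then show "(\<Sum>i\<in>A. f i * of_bool (d v x = i)) = kern \<mu> v x"
      "(\<Sum>j\<in>B. g j * of_bool (d x w = j)) = kern \<nu> x w"
      using fin by (auto simp: of_bool_def if_distrib kern_def f_def g_def cong: if_cong)
  qed
  finally show ?thesis .
qed

text \<open>Any finite set carrying all nonzero terms may replace the row; this serves the column
  form and the neutral element.\<close>

lemma kern_gconv:
  assumes "v0 \<in> V" "v \<in> V" "w \<in> V" "finite X" "X \<subseteq> V"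
    and "\<And>x. x \<in> V - X \<Longrightarrow> kern \<mu> v x * kern \<nu> x w = 0"
  shows "kern (gconv V E v0 \<mu> \<nu>) v w = (\<Sum>x\<in>X. kern \<mu> v x * kern \<nu> x w)"
  unfolding kern_gconv_row[OF assms(1-3)]
proof (rule sum.mono_neutral_cong)
  show "finite (row \<mu> v)" using assms finite_row by blast
  show "kern \<mu> v x * kern \<nu> x w = 0" if "x \<in> X - row \<mu> v" for x
    using that assms kern_outside_row by (metis Diff_iff mult_zero_left subsetD)
  show "kern \<mu> v x * kern \<nu> x w = 0" if "x \<in> row \<mu> v - X" for x
    using that assms by (simp add: row_def)
qed (use assms in simp_all)

text \<open>By symmetry, column \<open>w\<close> of the right factor is supported on
  \<open>row \<nu> w\<close>.\<close>

lemma kern_gconv_col: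
  assumes "v0 \<in> V" "v \<in> V" "w \<in> V"
  shows "kern (gconv V E v0 \<mu> \<nu>) v w = (\<Sum>x\<in>row \<nu> w. kern \<mu> v x * kern \<nu> x w)"
  by (rule kern_gconv)
     (use assms finite_row row_subset kern_outside_row[of _ \<nu> w] kern_sym[of w _ \<nu>] in auto)

section \<open>Algebra laws inherited from matrix products\<close>

lemma gconv_assoc:
  assumes "v0 \<in> V"
  shows "gconv V E v0 (gconv V E v0 \<mu> \<nu>) \<rho> = gconv V E v0 \<mu> (gconv V E v0 \<nu> \<rho>)"
proof (rule kern_eqI)
  fix v w assume vw: "v \<in> V" "w \<in> V"
  \<comment> \<open>Using the row of the left factor and the column of the right one makes both
    index sets independent of the summation variables, so the finite sums can be swapped.\<close>
  have "kern (gconv V E v0 (gconv V E v0 \<mu> \<nu>) \<rho>) v w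
      = (\<Sum>y\<in>row \<rho> w. \<Sum>x\<in>row \<mu> v. kern \<mu> v x * kern \<nu> x y * kern \<rho> y w)"
    unfolding kern_gconv_col[OF assms vw]
    by (intro sum.cong refl) (use assms vw row_subset in
      \<open>auto simp: kern_gconv_row sum_distrib_right subset_iff\<close>)
  also have "\<dots> = (\<Sum>x\<in>row \<mu> v. \<Sum>y\<in>row \<rho> w. kern \<mu> v x * kern \<nu> x y * kern \<rho> y w)"
    by (rule sum.swap)
  also have "\<dots> = kern (gconv V E v0 \<mu> (gconv V E v0 \<nu> \<rho>)) v w"
    unfolding kern_gconv_row[OF assms vw]
    by (intro sum.cong refl) (use assms vw row_subset in
      \<open>auto simp: kern_gconv_col sum_distrib_left mult.assoc subset_iff\<close>)
  finally show "kern (gconv V E v0 (gconv V E v0 \<mu> \<nu>) \<rho>) v w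
      = kern (gconv V E v0 \<mu> (gconv V E v0 \<nu> \<rho>)) v w" .
qed (rule gconv_in_free_cspace)+

text \<open>Transposing a product of symmetric matrices reverses the factors, and the product, being
  a kernel again, is itself symmetric.\<close>

lemma gconv_commute:
  assumes "v0 \<in> V"
  shows "gconv V E v0 \<mu> \<nu> = gconv V E v0 \<nu> \<mu>"
proof (rule kern_eqI)
  fix v w assume vw: "v \<in> V" "w \<in> V"
  have "kern \<mu> v x * kern \<nu> x w = kern \<nu> w x * kern \<mu> x v" if "x \<in> row \<mu> v" for x
    using that vw row_subset[of \<mu> v] kern_sym[of v x \<mu>] kern_sym[of x w \<nu>] by auto
  then have "kern (gconv V E v0 \<mu> \<nu>) v w = kern (gconv V E v0 \<nu> \<mu>) w v"
    by (simp add: kern_gconv_row[OF assms vw] kern_gconv_col[OF assms vw(2,1)])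
  then show "kern (gconv V E v0 \<mu> \<nu>) v w = kern (gconv V E v0 \<nu> \<mu>) v w"
    using kern_sym vw by simp
qed (rule gconv_in_free_cspace)+

text \<open>The summation set \<open>row \<mu> v\<close> depends only on the left factor, so
  linearity is immediate on the right; commutativity carries it to the left.\<close>

lemma gconv_add_right:
  assumes "v0 \<in> V"
  shows "gconv V E v0 \<mu> (\<nu> + \<nu>') = gconv V E v0 \<mu> \<nu> + gconv V E v0 \<mu> \<nu>'"
  by (rule kern_eqI)
     (simp_all add: gconv_in_free_cspace free_cspace_add kern_gconv_row assms kern_add
       distrib_left sum.distrib)

lemma gconv_cscale_right:
  assumes "v0 \<in> V"
  shows "gconv V E v0 \<mu> (cscale c \<nu>) = cscale c (gconv V E v0 \<mu> \<nu>)"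
  by (rule kern_eqI)
     (simp_all add: gconv_in_free_cspace free_cspace_cscale kern_gconv_row assms kern_cscale
       sum_distrib_left mult_ac)

lemma row_conj_star: "row (conj_star \<mu>) v = row \<mu> v"
  by (simp add: row_def in_keys_iff lookup_conj_star)

lemma conj_star_gconv:
  assumes "v0 \<in> V"
  shows "conj_star (gconv V E v0 \<mu> \<nu>) = gconv V E v0 (conj_star \<mu>) (conj_star \<nu>)"
  by (rule kern_eqI)
     (simp_all add: gconv_in_free_cspace free_cspace_conj_star kern_gconv_row assms
       kern_conj_star row_conj_star)

lemma gconv_neutral:
  assumes "v0 \<in> V" "\<mu> \<in> free_cspace (grels V E)"
  shows "gconv V E v0 (point (grel V E 0)) \<mu> = \<mu>"
proof (rule kern_eqI)
  fix v w assume vw: "v \<in> V" "w \<in> V"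
  \<comment> \<open>As \<open>n 0 = 1\<close>, the element \<open>R_0\<close> is represented by the
    identity matrix.\<close>
  have delta: "kern (point (grel V E 0)) v x = (if v = x then 1 else 0)" if "x \<in> V" for x
  proof -
    have "grel V E 0 = grel V E (d v x) \<longleftrightarrow> d v x = 0"
      using inj_on_eq_iff[OF inj_on_grel zero_in_gindex gdist_in_gindex[OF vw(1) that]] by simp
    moreover have "n 0 = 1"
      using card_gsphere[OF vw(1), of 0] gsphere_0[OF vw(1)] by simp
    ultimately show ?thesis
      using gdist_eq_0_iff[OF vw(1) that] by (auto simp: kern_def lookup_point)
  qed
  have "kern (gconv V E v0 (point (grel V E 0)) \<mu>) v w
      = (\<Sum>x\<in>{v}. kern (point (grel V E 0)) v x * kern \<mu> x w)"
    by (rule kern_gconv) (use assms vw delta in auto)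
  then show "kern (gconv V E v0 (point (grel V E 0)) \<mu>) v w = kern \<mu> v w"
    using delta vw by simp
qed (use assms gconv_in_free_cspace in auto)

section \<open>The hypergroup\<close>

text \<open>The coefficients are nonnegative, and for \<open>d v w = i\<close> the numbers
  \<open>p j k i\<close> sort the sphere \<open>S j v\<close> by distance \<open>k\<close> from
  \<open>w\<close>, so they add up to \<open>n j\<close>.\<close>

lemma norm1_gprod:
  assumes "v0 \<in> V" "i \<in> gindex V E" "j \<in> gindex V E"
  shows "norm1 (gprod V E v0 i j) = 1"
proof -
  define Q where "Q = {k \<in> gindex V E. gcoeff V E v0 i j k \<noteq> 0}"
  obtain v w where vw: "v \<in> V" "w \<in> V" "d v w = i" using gindex_gdistE[OF assms(2)] .
  have keys: "Poly_Mapping.keys (gprod V E v0 i j) = grel V E ` Q"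
    using gprod_in_free_cspace[of v0 i j] lookup_gprod[OF assms(1,2), of _ j]
    by (fastforce simp: Q_def in_keys_iff free_cspace_iff grels_def)
  have "norm1 (gprod V E v0 i j) = (\<Sum>k\<in>Q. cmod (Poly_Mapping.lookup (gprod V E v0 i j) (grel V E k)))"
    unfolding norm1_def keys
    by (subst sum.reindex) (auto simp: Q_def intro: inj_on_subset[OF inj_on_grel])
  also have "\<dots> = (\<Sum>k\<in>Q. real (p j k i) / real (n j))"
    by (intro sum.cong refl) (use assms in \<open>auto simp: Q_def lookup_gprod gcoeff_eq norm_divide\<close>)
  also have "\<dots> = real (\<Sum>k\<in>Q. \<Sum>x\<in>{x \<in> S j v. d w x = k}. 1) / real (n j)"
  proof -
    have "p j k i = (\<Sum>x\<in>{x \<in> S j v. d w x = k}. 1)" for k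
      using card_Int[OF vw(1,2), of j k] vw(3)
      by (auto simp: Int_def mem_gsphere_iff conj_ac intro!: arg_cong[of _ _ card])
    then show ?thesis by (simp add: sum_divide_distrib)
  qed
  also have "(\<Sum>k\<in>Q. \<Sum>x\<in>{x \<in> S j v. d w x = k}. 1) = (\<Sum>x\<in>S j v. 1)"
  proof (rule sum.group)
    show "finite (S j v)" by (simp add: finite_gsphere vw)
    show "finite Q" unfolding Q_def by (rule finite_gcoeff_support[OF assms(1,2)])
    \<comment> \<open>Each distance from \<open>w\<close> into the sphere has a nonzero coefficient,
      so grouping over \<open>Q\<close> covers the whole sphere.\<close>
    show "d w ` S j v \<subseteq> Q"
    proof safe
      fix x assume x: "x \<in> S j v"
      then have xV: "x \<in> V" by (simp add: mem_gsphere_iff)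
      then have "x \<in> S j v \<inter> S (d w x) w" using x by (simp add: mem_gsphere_iff)
      then have "card (S j v \<inter> S (d w x) w) \<noteq> 0" using finite_gsphere[OF vw(2)] by auto
      then have "p j (d w x) i \<noteq> 0" by (simp add: card_Int vw)
      then show "d w x \<in> Q"
        using gdist_in_gindex[OF vw(2) xV] n_pos[OF assms(3)] by (simp add: Q_def gcoeff_eq assms)
    qed
  qed
  also have "real (\<Sum>x\<in>S j v. 1) / real (n j) = 1"
    using n_pos[OF assms(3)] by (simp add: card_gsphere vw)
  finally show ?thesis .
qed

text \<open>The coefficient of \<open>R_0\<close> is \<open>p j 0 i / n j\<close>, and
  \<open>w\<close> is the only candidate counted by \<open>p j 0 i\<close>; it lies in
  \<open>S j v\<close> exactly when \<open>i = j\<close>.\<close>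

lemma zero_in_support_iff:
  assumes "v0 \<in> V" "i \<in> gindex V E" "j \<in> gindex V E"
  shows "grel V E 0 \<in> Poly_Mapping.keys (gprod V E v0 i j) \<longleftrightarrow> i = j"
proof -
  obtain v w where vw: "v \<in> V" "w \<in> V" "d v w = i" using gindex_gdistE[OF assms(2)] .
  have "S j v \<inter> S 0 w = (if i = j then {w} else {})"
    using vw by (auto simp: gsphere_0 mem_gsphere_iff)
  then have "p j 0 i = (if i = j then 1 else 0)"
    using card_Int[OF vw(1,2), of j 0] vw(3) by (simp split: if_splits)
  then show ?thesis
    using assms n_pos[OF assms(3)]
    by (simp add: in_keys_iff lookup_gprod zero_in_gindex gcoeff_eq)
qed

text \<open>Commutativity supplies linearity on the left, the right neutral law and the reversal of
  factors under \<open>conj_star\<close>.\<close>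

theorem hermitian_discrete_hypergroup_gconv:
  assumes v0: "v0 \<in> V"
  shows "hermitian_discrete_hypergroup (grels V E) (gconv V E v0) conj_star (grel V E 0)"
proof
  fix \<mu> \<mu>' \<nu> \<nu>' \<rho> :: "('a \<times> 'a) set \<Rightarrow>\<^sub>0 complex" and c :: complex
  show "gconv V E v0 \<mu> \<nu> \<in> free_cspace (grels V E)" by (rule gconv_in_free_cspace)
  show "gconv V E v0 \<mu> (\<nu> + \<nu>') = gconv V E v0 \<mu> \<nu> + gconv V E v0 \<mu> \<nu>'"
    by (rule gconv_add_right[OF v0])
  show "gconv V E v0 (\<mu> + \<mu>') \<nu> = gconv V E v0 \<mu> \<nu> + gconv V E v0 \<mu>' \<nu>"
    using gconv_add_right[OF v0, of \<nu> \<mu> \<mu>'] by (simp add: gconv_commute[OF v0, of _ \<nu>])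
  show "gconv V E v0 \<mu> (cscale c \<nu>) = cscale c (gconv V E v0 \<mu> \<nu>)"
    by (rule gconv_cscale_right[OF v0])
  show "gconv V E v0 (cscale c \<mu>) \<nu> = cscale c (gconv V E v0 \<mu> \<nu>)"
    using gconv_cscale_right[OF v0, of \<nu> c \<mu>] by (simp add: gconv_commute[OF v0, of _ \<nu>])
  show "gconv V E v0 (gconv V E v0 \<mu> \<nu>) \<rho> = gconv V E v0 \<mu> (gconv V E v0 \<nu> \<rho>)"
    by (rule gconv_assoc[OF v0])
  show "conj_star \<mu> \<in> free_cspace (grels V E)" if "\<mu> \<in> free_cspace (grels V E)"
    using that by (rule free_cspace_conj_star)
  show "conj_star (\<mu> + \<nu>) = conj_star \<mu> + conj_star \<nu>"
    by (rule poly_mapping_eqI) (simp add: lookup_conj_star lookup_add)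
  show "conj_star (cscale c \<mu>) = cscale (cnj c) (conj_star \<mu>)"
    by (rule poly_mapping_eqI) (simp add: lookup_conj_star lookup_cscale)
  show "conj_star (conj_star \<mu>) = \<mu>"
    by (rule poly_mapping_eqI) (simp add: lookup_conj_star)
  show "conj_star (gconv V E v0 \<mu> \<nu>) = gconv V E v0 (conj_star \<nu>) (conj_star \<mu>)"
    using conj_star_gconv[OF v0] gconv_commute[OF v0] by simp
  show "grel V E 0 \<in> grels V E" using zero_in_gindex by (simp add: grels_def)
  show "gconv V E v0 (point (grel V E 0)) \<mu> = \<mu>" if "\<mu> \<in> free_cspace (grels V E)"
    using gconv_neutral[OF v0 that] .
  then show "gconv V E v0 \<mu> (point (grel V E 0)) = \<mu>" if "\<mu> \<in> free_cspace (grels V E)"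
    using that gconv_commute[OF v0] by simp
  show "conj_star ` point ` grels V E = point ` grels V E"
    by (simp add: image_image conj_star_point)
next
  fix x y assume xy: "x \<in> grels V E" "y \<in> grels V E"
  then obtain i j where i: "i \<in> gindex V E" "x = grel V E i" and j: "j \<in> gindex V E" "y = grel V E j"
    by (auto simp: grels_def)
  have *: "gconv V E v0 (point x) (point y) = gprod V E v0 i j"
    using i j gconv_point by simp
  show "norm1 (gconv V E v0 (point x) (point y)) = 1"
    using * norm1_gprod v0 i j by simp
  show "grel V E 0 \<in> Poly_Mapping.keys (gconv V E v0 (point x) (point y))
      \<longleftrightarrow> point y = conj_star (point x)"
    using * zero_in_support_iff[OF v0 i(1) j(1)] inj_on_eq_iff[OF inj_on_grel i(1) j(1)] i j
    by (auto simp: conj_star_point point_eq_iff)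
  fix z assume "z \<in> grels V E"
  then obtain k where "k \<in> gindex V E" "z = grel V E k" by (auto simp: grels_def)
  then show "Poly_Mapping.lookup (gconv V E v0 (point x) (point y)) z \<in> \<real>
      \<and> 0 \<le> Re (Poly_Mapping.lookup (gconv V E v0 (point x) (point y)) z)"
    using * lookup_gprod v0 i gcoeff_eq by simp
qed (simp_all add: conj_star_point)

end

theorem theorem3p3:
  fixes V :: "'a set" and E :: "'a set set"
  assumes "distance_regular V E"
  shows
    "(\<forall>v0\<in>V.
        (\<forall>i\<in>gindex V E. card (gsphere V E i v0) \<noteq> 0) \<and>
        (\<forall>i\<in>gindex V E. \<forall>j\<in>gindex V E. \<forall>v\<in>gsphere V E i v0. card (gsphere V E j v) \<noteq> 0) \<and>
        (\<forall>i\<in>gindex V E. \<forall>j\<in>gindex V E. finite {k \<in> gindex V E. gcoeff V E v0 i j k \<noteq> 0}) \<and>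
        (\<exists>e. hermitian_discrete_hypergroup (grels V E) (gconv V E v0) conj_star e)) \<and>
     (\<forall>v0\<in>V. \<forall>v1\<in>V. \<forall>\<mu>\<in>free_cspace (grels V E). \<forall>\<nu>\<in>free_cspace (grels V E).
        gconv V E v0 \<mu> \<nu> = gconv V E v1 \<mu> \<nu>)"
proof -
  interpret lf_connected_graph V E using assms by (simp add: distance_regular_def)
  from intersection_numbers[OF assms] obtain p where
    "\<And>j i v w. v \<in> V \<Longrightarrow> w \<in> V \<Longrightarrow> card (S i v \<inter> S j w) = p j i (d v w)"
    by metis
  \<comment> \<open>The numbers were chosen per radius of the second sphere, so that radius is the
    first argument of \<open>p\<close> and the order is exchanged here.\<close>
  then interpret graph_with_intersection_numbers V E "\<lambda>i j. p j i"
    by unfold_locales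
  have nonzero: "card (S i v) \<noteq> 0" if "i \<in> gindex V E" "v \<in> V" for i v
    using n_pos[OF that(1)] card_gsphere[OF that(2)] by simp
  show ?thesis
  proof (intro conjI ballI)
    \<comment> \<open>The matrix product does not mention the base point, and faithfulness of
      \<open>kern\<close> carries this back to the convolution.\<close>
    fix v0 v1 \<mu> \<nu> assume "v0 \<in> V" "v1 \<in> V"
    then show "gconv V E v0 \<mu> \<nu> = gconv V E v1 \<mu> \<nu>"
      by (intro kern_eqI gconv_in_free_cspace) (simp add: kern_gconv_row)
  next
    fix v0 assume "v0 \<in> V"
    then show "\<exists>e. hermitian_discrete_hypergroup (grels V E) (gconv V E v0) conj_star e"
      using hermitian_discrete_hypergroup_gconv by blast
  qed (use nonzero finite_gcoeff_support in \<open>auto simp: mem_gsphere_iff\<close>)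
qed

end
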